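(* Let $I\subseteq\mathbb{R}$ be an interval and let $\mathcal{F}=(f_x\colon I\to\mathbb{R})_{x\in[0,1]}$ be an admissible family which is upper bounded (respectively, lower bounded). Then there exists a uniquely determined $\mathbf{A}_{\mathcal{F}}$-invariant mean $K_{\mathcal{F}}\colon\mathcal{P}(I)\to I$ such that $$\lim_{n\to\infty}\mathscr{A}^{[k]}\big(\mathbf{A}_{\mathcal{F}}^n(\mathbb{P})\big)=K_{\mathcal{F}}(\mathbb{P})\qquad\text{for all }k\in\mathcal{CM}(I)\text{ and }\mathbb{P}\in\mathcal{P}(I).$$
   Context: Let $I\subseteq\mathbb{R}$ be an interval. $\mathcal{CM}(I)$ is the family of all continuous, strictly monotone functions $I\to\mathbb{R}$. $\mathcal{P}(I)$ denotes the family of all compactly supported probability measures on the Borel $\sigma$-algebra $\mathcal{B}(I)$. For $\mathbb{P}\in\mathcal{P}(I)$ put $\gamma(\mathbb{P}):=[\inf\operatorname{supp}\mathbb{P},\sup\operatorname{supp}\mathbb{P}]$. A (integral) mean on $I$ is a function $M\colon\mathcal{P}(I)\to I$ with $M(\mathbb{P})\in\gamma(\mathbb{P})$ for all $\mathbb{P}\in\mathcal{P}(I)$. For $f\in\mathcal{CM}(I)$, the quasiarithmetic mean $\mathscr{A}^{[f]}\colon\mathcal{P}(I)\to I$ is $\mathscr{A}^{[f]}(\mathbb{P}):=f^{-1}\big(\int f(x)\,d\mathbb{P}(x)\big)$. Means are ordered pointwise on $\mathcal{P}(I)$. A family $\mathcal{F}=(f_x)_{x\in[0,1]}$ of functions $f_x\colon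 I\to\mathbb{R}$ is admissible if (1) each $f_x$ is continuous and strictly monotone, and (2) the function $I\times[0,1]\ni(t,x)\mapsto f_x(t)$ is measurable with respect to the product $\sigma$-algebra $\mathcal{B}(I)\times\mathcal{L}[0,1]$, where $\mathcal{L}[0,1]$ is the Lebesgue $\sigma$-algebra on $[0,1]$. The family $\mathcal{F}$ is upper bounded (respectively, lower bounded) if there exists $u\in\mathcal{CM}(I)$ such that $\mathscr{A}^{[f_x]}\le\mathscr{A}^{[u]}$ (respectively, $\mathscr{A}^{[f_x]}\ge\mathscr{A}^{[u]}$) for all $x\in[0,1]$. For an admissible family $\mathcal{F}$ and $\mathbb{P}\in\mathcal{P}(I)$, $\mathbf{A}_{\mathcal{F}}(\mathbb{P})$ is the Borel measure $S\mapsto|\{x\in[0,1]\colon\mathscr{A}^{[f_x]}(\mathbb{P})\in S\}|$, where $|\cdot|$ is Lebesgue measure; it is an element of $\mathcal{P}(I)$, so $\mathbf{A}_{\mathcal{F}}$ is a selfmap of $\mathcal{P}(I)$, and $\mathbf{A}_{\mathcal{F}}^n$ denotes its $n$-th iterate. A mean $M\colon\mathcal{P}(I)\to I$ is $\mathbf{A}_{\mathcal{F}}$-invariant if $M\circ\mathbf{A}_{\mathcal{F}}=M$. *)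

theory Defs
  imports "HOL-Probability.Probability"
begin

definition CM :: "real set \<Rightarrow> (real \<Rightarrow> real) set" where
  "CM I = {f. continuous_on I f \<and> (strict_mono_on I f \<or> strict_antimono_on I f)}"

(* The support is taken relative to the space of the measure: below this space is an
   interval I with its subspace topology, so the support is a subset of I. *)
definition msupp :: "'a::topological_space measure \<Rightarrow> 'a set" where
  "msupp P = {x \<in> space P. \<forall>U. open U \<and> x \<in> U \<longrightarrow> emeasure P (U \<inter> space P) > 0}"

definition compact_probs :: "real set \<Rightarrow> real measure set" where
  "compact_probs I =
     {P. prob_space P \<and> sets P = sets (restrict_space borel I) \<and> compact (msupp P)}"

definition supp_hull :: "real measure \<Rightarrow> real set" where
  "supp_hull P = {Inf (msupp P) .. Sup (msupp P)}"

(* Means are extensional (undefined outside compact_probs I), so that equality of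
   means in HOL is equality of functions on compact_probs I. *)
definition is_mean :: "real set \<Rightarrow> (real measure \<Rightarrow> real) \<Rightarrow> bool" where
  "is_mean I M \<longleftrightarrow> M \<in> compact_probs I \<rightarrow>\<^sub>E I \<and> (\<forall>P\<in>compact_probs I. M P \<in> supp_hull P)"

definition qa_mean :: "real set \<Rightarrow> (real \<Rightarrow> real) \<Rightarrow> real measure \<Rightarrow> real" where
  "qa_mean I f = (\<lambda>P\<in>compact_probs I. inv_into I f (LINT x|P. f x))"

definition mean_le :: "real set \<Rightarrow> (real measure \<Rightarrow> real) \<Rightarrow> (real measure \<Rightarrow> real) \<Rightarrow> bool" where
  "mean_le I M N \<longleftrightarrow> (\<forall>P\<in>compact_probs I. M P \<le> N P)"

(* A family is written f x t with index x in [0,1] and argument t in I; its values for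
   other x or t are irrelevant. *)
definition admissible :: "real set \<Rightarrow> (real \<Rightarrow> real \<Rightarrow> real) \<Rightarrow> bool" where
  "admissible I f \<longleftrightarrow> (\<forall>x\<in>{0..1}. f x \<in> CM I) \<and>
     (\<lambda>(t, x). f x t) \<in> borel_measurable (restrict_space borel I \<Otimes>\<^sub>M lebesgue_on {0..1})"

definition upper_bounded :: "real set \<Rightarrow> (real \<Rightarrow> real \<Rightarrow> real) \<Rightarrow> bool" where
  "upper_bounded I f \<longleftrightarrow>
     (\<exists>u\<in>CM I. \<forall>x\<in>{0..1}. mean_le I (qa_mean I (f x)) (qa_mean I u))"

definition lower_bounded :: "real set \<Rightarrow> (real \<Rightarrow> real \<Rightarrow> real) \<Rightarrow> bool" where
  "lower_bounded I f \<longleftrightarrow>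
     (\<exists>u\<in>CM I. \<forall>x\<in>{0..1}. mean_le I (qa_mean I u) (qa_mean I (f x)))"

(* The image of Lebesgue measure on [0,1] under the map sending x to qa_mean I (f x) P,
   i.e. S is mapped to the Lebesgue measure of {x \<in> {0..1}. qa_mean I (f x) P \<in> S}. *)
definition mean_map :: "real set \<Rightarrow> (real \<Rightarrow> real \<Rightarrow> real) \<Rightarrow> real measure \<Rightarrow> real measure" where
  "mean_map I f P =
     distr (lebesgue_on {0..1}) (restrict_space borel I) (\<lambda>x. qa_mean I (f x) P)"

definition invariant_mean ::
    "real set \<Rightarrow> (real \<Rightarrow> real \<Rightarrow> real) \<Rightarrow> (real measure \<Rightarrow> real) \<Rightarrow> bool" where
  "invariant_mean I f M \<longleftrightarrow>
     is_mean I M \<and> (\<forall>P\<in>compact_probs I. M (mean_map I f P) = M P)"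

end

(* Up to the sign of the generator u of the bound, there is a w in CM I such that
   w (A^[f_x] P) \<le> \<integral> w dP for all x and P.  For the iterates P_n of P, the numbers
   V_n = \<integral> w dP_n then decrease to some w c, and because the integrand
   V_n - w (A^[f_x] P_n) is nonnegative with integral V_n - V_(n+1), the iterates
   satisfy \<integral> |w - w c| dP_n \<longlonglongrightarrow> 0.  Since w is a homeomorphism onto
   its image on the compact hull of the support of P, this forces \<integral> k dP_n \<longlonglongrightarrow> k c
   for every continuous k. *)
theory Submission
  imports Defs
begin

section \<open>Supports and hulls of compactly supported measures\<close>

lemma msupp_eq:
  "msupp P = space P - \<Union>{U. open U \<and> emeasure P (U \<inter> space P) = 0}"
  unfolding msupp_def by (auto simp: zero_less_iff_neq_zero)

text \<open>Off the support every point has an open null neighbourhood. By second countability,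
  Lindelof's theorem replaces the union of all open null sets by a countable one, which is still
  null.\<close>

lemma AE_msupp:
  fixes P :: "'a::second_countable_topology measure"
  assumes "sets P = sets (restrict_space borel S)"
  shows "AE t in P. t \<in> msupp P"
proof -
  have sp: "space P = S"
    using sets_eq_imp_space_eq[OF assms] by (simp add: space_restrict_space)
  let ?F = "{U. open U \<and> emeasure P (U \<inter> space P) = 0}"
  obtain F' where F': "F' \<subseteq> ?F" "countable F'" "\<Union>F' = \<Union>?F"
    by (rule Lindelof[of ?F]) auto
  have "U \<inter> space P \<in> null_sets P" if "U \<in> F'" for U
  proof -
    have "U \<inter> space P \<in> sets (restrict_space borel S)"
      unfolding sets_restrict_space sp using that F'(1) by (intro image_eqI[of _ _ U]) auto
    then show ?thesis
      using that F'(1) assms by (intro null_setsI) auto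
  qed
  then have "(\<Union>U\<in>F'. U \<inter> space P) \<in> null_sets P"
    using F'(2) by (intro null_sets_UN') auto
  then have "AE t in P. t \<notin> (\<Union>U\<in>F'. U \<inter> space P)"
    by (rule AE_not_in)
  then show ?thesis
    using AE_space
  proof eventually_elim
    case (elim t)
    then have "t \<notin> \<Union>?F" unfolding F'(3)[symmetric] by blast
    then show ?case using elim(2) unfolding msupp_eq by blast
  qed
qed

lemma compact_probs_space:
  assumes "P \<in> compact_probs I"
  shows "space P = I"
proof -
  have "sets P = sets (restrict_space borel I)"
    using assms by (simp add: compact_probs_def)
  from sets_eq_imp_space_eq[OF this] show ?thesis
    by (simp add: space_restrict_space)
qed

text \<open>A probability measure cannot live on an empty support, so the compact support attains
  its infimum and supremum. Both lie in \<open>I\<close>, because the support is taken relative to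
  \<open>I\<close>, and convexity of \<open>I\<close> fills in the rest of the hull.\<close>

lemma compact_probs_hull:
  assumes "is_interval I" "P \<in> compact_probs I"
  obtains a b where "supp_hull P = {a..b}" "a \<le> b" "{a..b} \<subseteq> I" "AE t in P. t \<in> {a..b}"
proof -
  interpret prob_space P using assms(2) by (simp add: compact_probs_def)
  have sets: "sets P = sets (restrict_space borel I)" and cmp: "compact (msupp P)"
    using assms(2) by (auto simp: compact_probs_def)
  have AE: "AE t in P. t \<in> msupp P" by (rule AE_msupp[OF sets])
  have ne: "msupp P \<noteq> {}"
  proof
    assume "msupp P = {}"
    with AE have "AE t in P. False" by simp
    then show False by simp
  qed
  have bdd: "bdd_below (msupp P)" "bdd_above (msupp P)" and cl: "closed (msupp P)"
    using cmp by (simp_all add: compact_imp_bounded compact_imp_closed bounded_imp_bdd_below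
        bounded_imp_bdd_above)
  let ?a = "Inf (msupp P)" and ?b = "Sup (msupp P)"
  have ab: "?a \<in> msupp P" "?b \<in> msupp P"
    using closed_contains_Inf[OF ne bdd(1) cl] closed_contains_Sup[OF ne bdd(2) cl] by auto
  have sub: "msupp P \<subseteq> I"
    using compact_probs_space[OF assms(2)] by (auto simp: msupp_def)
  have mem: "msupp P \<subseteq> {?a..?b}"
    using bdd by (auto intro: cInf_lower cSup_upper)
  show thesis
  proof (rule that)
    show "supp_hull P = {?a..?b}" by (simp add: supp_hull_def)
    show "?a \<le> ?b" using ab mem by auto
    show "{?a..?b} \<subseteq> I"
    proof
      fix t assume "t \<in> {?a..?b}"
      then show "t \<in> I"
        using mem_is_interval_1_I[OF assms(1), of ?a ?b t] ab sub by auto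
    qed
    show "AE t in P. t \<in> {?a..?b}" by (rule eventually_mono[OF AE]) (use mem in blast)
  qed
qed

text \<open>The complement of \<open>{a..b}\<close> is itself one of the open null sets, so the
  support is \<open>{a..b}\<close> minus an open set and hence compact. This is how membership in
  \<open>compact_probs I\<close> is proved for image measures.\<close>

lemma compact_probsI:
  assumes "prob_space P" "sets P = sets (restrict_space borel I)"
    and "{a..b} \<subseteq> I" "AE t in P. t \<in> {a..b}"
  shows "P \<in> compact_probs I" "supp_hull P \<subseteq> {a..b}"
proof -
  interpret prob_space P by fact
  have sp: "space P = I"
    using sets_eq_imp_space_eq[OF assms(2)] by (simp add: space_restrict_space)
  let ?F = "{U. open U \<and> emeasure P (U \<inter> space P) = 0}"
  have "emeasure P (- {a..b} \<inter> space P) = 0"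
  proof -
    have "- {a..b} \<inter> space P \<in> sets (restrict_space borel I)"
      by (auto simp: sets_restrict_space sp image_iff)
    moreover have "AE t in P. t \<notin> - {a..b} \<inter> space P" using assms(4) by auto
    ultimately show ?thesis
      using AE_iff_null_sets[of "- {a..b} \<inter> space P" P] assms(2) by auto
  qed
  then have "- {a..b} \<in> ?F" by auto
  then have eq: "msupp P = {a..b} - \<Union>?F"
    unfolding msupp_eq using assms(3) sp by blast
  have "open (\<Union>?F)" by (rule open_Union) auto
  then have cmp: "compact (msupp P)"
    unfolding eq by (intro compact_diff) auto
  with assms show "P \<in> compact_probs I" by (simp add: compact_probs_def)
  have ne: "msupp P \<noteq> {}"
  proof
    assume "msupp P = {}"
    with AE_msupp[OF assms(2)] have "AE t in P. False" by simp
    then show False by simp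
  qed
  have "a \<le> Inf (msupp P)" "Sup (msupp P) \<le> b"
    using ne eq by (auto intro!: cInf_greatest cSup_least)
  then show "supp_hull P \<subseteq> {a..b}" by (auto simp: supp_hull_def)
qed

section \<open>Integrals of continuous functions and quasiarithmetic means\<close>

lemma compact_probs_measurable:
  assumes "P \<in> compact_probs I" "continuous_on I g"
  shows "g \<in> borel_measurable P"
proof -
  have "sets P = sets (restrict_space borel I)"
    using assms(1) by (simp add: compact_probs_def)
  with borel_measurable_continuous_on_restrict[OF assms(2)] show ?thesis
    by (simp cong: measurable_cong_sets)
qed

lemma compact_probs_integrable:
  fixes g :: "real \<Rightarrow> real"
  assumes "is_interval I" "P \<in> compact_probs I" "continuous_on I g"
  shows "integrable P g"
proof -
  interpret prob_space P using assms(2) by (simp add: compact_probs_def)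
  obtain a b where "supp_hull P = {a..b}" "a \<le> b" and ab: "{a..b} \<subseteq> I" "AE t in P. t \<in> {a..b}"
    by (rule compact_probs_hull[OF assms(1,2)])
  have "bounded (g ` {a..b})"
    by (intro compact_imp_bounded compact_continuous_image continuous_on_subset[OF assms(3)] ab) auto
  then obtain B where "\<And>t. t \<in> {a..b} \<Longrightarrow> norm (g t) \<le> B"
    unfolding bounded_iff by blast
  with ab(2) have "AE t in P. norm (g t) \<le> B" by auto
  then show ?thesis
    by (rule integrable_const_bound) (rule compact_probs_measurable[OF assms(2,3)])
qed

text \<open>A continuous image of \<open>{a..b}\<close> is a closed interval, and an average of
  values from a closed interval stays in it. Consequently \<open>inv_into\<close> in
  \<open>qa_mean\<close> is applied to a value that is really attained.\<close>

lemma integral_mem_image: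
  fixes g :: "real \<Rightarrow> real"
  assumes "is_interval I" "P \<in> compact_probs I" "continuous_on I g"
    and "a \<le> b" "{a..b} \<subseteq> I" "AE t in P. t \<in> {a..b}"
  shows "(LINT t|P. g t) \<in> g ` {a..b}"
proof -
  interpret prob_space P using assms(2) by (simp add: compact_probs_def)
  note int = compact_probs_integrable[OF assms(1-3)]
  obtain c d where cd: "g ` {a..b} = {c..d}"
    using continuous_image_closed_interval[OF assms(4) continuous_on_subset[OF assms(3,5)]] by blast
  then have *: "c \<le> g t \<and> g t \<le> d" if "t \<in> {a..b}" for t
    using that by (metis atLeastAtMost_iff imageI)
  have "AE t in P. c \<le> g t" "AE t in P. g t \<le> d"
    using eventually_mono[OF assms(6) *] by simp_all
  then have "c \<le> (LINT t|P. g t)" "(LINT t|P. g t) \<le> d"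
    using int by (auto intro: integral_ge_const integral_le_const)
  then show ?thesis unfolding cd by simp
qed

lemma CM_continuous: "k \<in> CM I \<Longrightarrow> continuous_on I k"
  by (simp add: CM_def)

lemma CM_inj: "k \<in> CM I \<Longrightarrow> inj_on k I"
  unfolding CM_def inj_on_def monotone_on_def
  by (auto, (metis less_irrefl linorder_neqE)+)

lemma qa_mean_props:
  assumes "is_interval I" "P \<in> compact_probs I" "k \<in> CM I"
  shows "qa_mean I k P \<in> supp_hull P" "qa_mean I k P \<in> I"
    and "k (qa_mean I k P) = (LINT t|P. k t)"
proof -
  obtain a b where ab: "supp_hull P = {a..b}" "a \<le> b" "{a..b} \<subseteq> I" "AE t in P. t \<in> {a..b}"
    by (rule compact_probs_hull[OF assms(1,2)])
  obtain s where s: "s \<in> {a..b}" "(LINT t|P. k t) = k s"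
    using integral_mem_image[OF assms(1,2) CM_continuous[OF assms(3)] ab(2-4)] by blast
  have "qa_mean I k P = s"
    using s ab(3) assms(2) inv_into_f_f[OF CM_inj[OF assms(3)], of s] by (auto simp: qa_mean_def)
  with s ab show "qa_mean I k P \<in> supp_hull P" "qa_mean I k P \<in> I"
    "k (qa_mean I k P) = (LINT t|P. k t)" by auto
qed

text \<open>The factor \<open>k b - k a\<close> carries the direction of monotonicity, so one
  inequality tests the order for increasing and decreasing \<open>k\<close> alike. This matters for
  families in which the direction of \<open>f x\<close> may change with \<open>x\<close>.\<close>

lemma CM_le_iff:
  assumes "k \<in> CM I" "a \<in> I" "b \<in> I" "s \<in> I" "q \<in> I" "a < b"
  shows "q \<le> s \<longleftrightarrow> (k q - k s) * (k b - k a) \<le> 0"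
proof -
  consider "strict_mono_on I k" | "strict_antimono_on I k"
    using assms(1) by (auto simp: CM_def)
  then show ?thesis
  proof cases
    case 1
    then have "k q \<le> k s \<longleftrightarrow> q \<le> s" "k a < k b"
      using assms strict_mono_on_less_eq[OF 1] by (auto simp: monotone_on_def)
    then show ?thesis by (auto simp: mult_le_0_iff)
  next
    case 2
    then have "k b < k a" using assms by (auto simp: monotone_on_def)
    moreover have "k s \<le> k q \<longleftrightarrow> q \<le> s"
      using 2 assms unfolding monotone_on_def by (metis less_le_not_le linorder_linear order_le_less)
    ultimately show ?thesis by (auto simp: mult_le_0_iff)
  qed
qed

section \<open>Measurability in the index, and the self-map on measures\<close>

lemma prob_space_lebesgue_unit: "prob_space (lebesgue_on {0..1::real})"
  by (rule prob_spaceI) (simp add: emeasure_restrict_space)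

text \<open>Inverse functions are avoided: sublevel sets are described by \<open>CM_le_iff\<close>
  in terms of slices \<open>f x s\<close> and the parameter integral, all of which are measurable in
  \<open>x\<close>.\<close>

lemma qa_mean_measurable:
  assumes "is_interval I" "admissible I f" "P \<in> compact_probs I"
  shows "(\<lambda>x. qa_mean I (f x) P) \<in> borel_measurable (lebesgue_on {0..1})"
proof -
  let ?L = "lebesgue_on {0..1::real}"
  interpret prob_space P using assms(3) by (simp add: compact_probs_def)
  obtain a b where ab: "supp_hull P = {a..b}" "a \<le> b" "{a..b} \<subseteq> I" "AE t in P. t \<in> {a..b}"
    by (rule compact_probs_hull[OF assms(1,3)])
  have CM: "f x \<in> CM I" if "x \<in> {0..1}" for x
    using assms(2) that by (auto simp: admissible_def)
  have meas: "(\<lambda>(t, x). f x t) \<in> borel_measurable (restrict_space borel I \<Otimes>\<^sub>M ?L)"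
    using assms(2) by (simp add: admissible_def)
  have slice: "(\<lambda>x. f x s) \<in> borel_measurable ?L" if "s \<in> I" for s
  proof -
    have "(\<lambda>x. (s, x)) \<in> ?L \<rightarrow>\<^sub>M restrict_space borel I \<Otimes>\<^sub>M ?L"
      using that by (intro measurable_Pair1') (simp add: space_restrict_space)
    from measurable_compose[OF this meas] show ?thesis by simp
  qed
  \<comment> \<open>Measurability of a parameter integral follows from joint measurability, with the
    integration variable second; hence the swap of the two factors.\<close>
  have integral: "(\<lambda>x. LINT t|P. f x t) \<in> borel_measurable ?L"
  proof (rule borel_measurable_lebesgue_integral)
    have "sets P = sets (restrict_space borel I)"
      using assms(3) by (simp add: compact_probs_def)
    then have "sets (P \<Otimes>\<^sub>M ?L) = sets (restrict_space borel I \<Otimes>\<^sub>M ?L)"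
      by (intro sets_pair_measure_cong) auto
    then have "(\<lambda>(t, x). f x t) \<in> borel_measurable (P \<Otimes>\<^sub>M ?L)"
      using meas measurable_cong_sets by blast
    from measurable_pair_swap[OF this]
    show "(\<lambda>(x, t). f x t) \<in> borel_measurable (?L \<Otimes>\<^sub>M P)"
      by (simp add: case_prod_beta)
  qed
  have qa: "qa_mean I (f x) P \<in> {a..b}" "f x (qa_mean I (f x) P) = (LINT t|P. f x t)"
    if "x \<in> {0..1}" for x
    using qa_mean_props[OF assms(1,3) CM[OF that]] ab by auto
  show ?thesis
    unfolding borel_measurable_iff_le
  proof
    fix s :: real
    let ?A = "{x \<in> space ?L. qa_mean I (f x) P \<le> s}"
    \<comment> \<open>Outside \<open>a \<le> s < b\<close> the sublevel set is empty or everything.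
      Inside, \<open>s\<close> lies in \<open>I\<close> and \<open>a < b\<close> holds, as
      \<open>CM_le_iff\<close> demands.\<close>
    consider "s < a" | "b \<le> s" | "a \<le> s" "s < b" by linarith
    then show "?A \<in> sets ?L"
    proof cases
      case 1
      then have "?A = {}" using qa by fastforce
      then show ?thesis by (metis sets.empty_sets)
    next
      case 2
      then have "?A = space ?L" using qa by fastforce
      then show ?thesis by (metis sets.top)
    next
      case 3
      then have I: "a \<in> I" "b \<in> I" "s \<in> I" using ab by auto
      have "?A = {x \<in> space ?L. ((LINT t|P. f x t) - f x s) * (f x b - f x a) \<le> 0}"
      proof (intro Collect_cong conj_cong refl)
        fix x assume "x \<in> space ?L"
        then have x: "x \<in> {0..1}" by simp
        then have "qa_mean I (f x) P \<in> I" using qa(1) ab(3) by blast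
        then show "qa_mean I (f x) P \<le> s \<longleftrightarrow>
            ((LINT t|P. f x t) - f x s) * (f x b - f x a) \<le> 0"
          using CM_le_iff[OF CM[OF x] I(1,2,3), of "qa_mean I (f x) P"] 3 qa(2)[OF x] by simp
      qed
      also have "\<dots> \<in> sets ?L"
        using slice[OF I(1)] slice[OF I(2)] slice[OF I(3)] integral by measurable
      finally show ?thesis .
    qed
  qed
qed

text \<open>All means of \<open>P\<close> lie in the hull of \<open>P\<close>, so the image measure
  is concentrated there and hulls can only shrink. The integral formula is the change of variables
  for \<open>distr\<close>.\<close>

lemma mean_map_props:
  assumes "is_interval I" "admissible I f" "P \<in> compact_probs I"
  shows "mean_map I f P \<in> compact_probs I" "supp_hull (mean_map I f P) \<subseteq> supp_hull P"
    and "\<And>g :: real \<Rightarrow> real. continuous_on I g \<Longrightarrow>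
      integrable (lebesgue_on {0..1}) (\<lambda>x. g (qa_mean I (f x) P)) \<and>
      (LINT t|mean_map I f P. g t) = (LINT x|lebesgue_on {0..1}. g (qa_mean I (f x) P))"
proof -
  let ?L = "lebesgue_on {0..1::real}"
  interpret L: prob_space ?L by (rule prob_space_lebesgue_unit)
  obtain a b where ab: "supp_hull P = {a..b}" "a \<le> b" "{a..b} \<subseteq> I" "AE t in P. t \<in> {a..b}"
    by (rule compact_probs_hull[OF assms(1,3)])
  have qa: "qa_mean I (f x) P \<in> {a..b}" "qa_mean I (f x) P \<in> I" if "x \<in> {0..1}" for x
    using qa_mean_props[OF assms(1,3), of "f x"] assms(2) that ab by (auto simp: admissible_def)
  have meas: "(\<lambda>x. qa_mean I (f x) P) \<in> ?L \<rightarrow>\<^sub>M restrict_space borel I"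
    using qa_mean_measurable[OF assms] qa(2) by (intro measurable_restrict_space2) auto
  have sets: "sets (mean_map I f P) = sets (restrict_space borel I)"
    by (simp add: mean_map_def)
  have prob: "prob_space (mean_map I f P)"
    unfolding mean_map_def by (rule L.prob_space_distr[OF meas])
  have "{t \<in> space (restrict_space borel I). t \<in> {a..b}} \<in> sets (restrict_space borel I)"
    unfolding sets_restrict_space by (rule image_eqI[of _ _ "{a..b}"]) (auto simp: space_restrict_space)
  then have "(AE t in mean_map I f P. t \<in> {a..b}) \<longleftrightarrow> (AE x in ?L. qa_mean I (f x) P \<in> {a..b})"
    unfolding mean_map_def by (rule AE_distr_iff[OF meas])
  then have AE: "AE t in mean_map I f P. t \<in> {a..b}"
    using qa(1) by (auto intro: AE_I2)
  show CP: "mean_map I f P \<in> compact_probs I"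
    and "supp_hull (mean_map I f P) \<subseteq> supp_hull P"
    using compact_probsI[OF prob sets ab(3) AE] ab(1) by auto
  fix g :: "real \<Rightarrow> real"
  assume g: "continuous_on I g"
  note gm = borel_measurable_continuous_on_restrict[OF g]
  have "integrable (mean_map I f P) g"
    by (rule compact_probs_integrable[OF assms(1) CP g])
  then show "integrable ?L (\<lambda>x. g (qa_mean I (f x) P)) \<and>
      (LINT t|mean_map I f P. g t) = (LINT x|?L. g (qa_mean I (f x) P))"
    unfolding mean_map_def using integrable_distr_eq[OF meas gm] integral_distr[OF meas gm] by simp
qed

section \<open>Comparing a continuous function with an injective one on a compact set\<close>

text \<open>Where \<open>\<bar>g t - g c\<bar> < e\<close> there is nothing to show. The remaining
  points form a compact set on which \<open>\<bar>h t - h c\<bar>\<close> is positive by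
  injectivity, so the quotient of the two distances has a positive minimum \<open>m\<close> there,
  and \<open>C = 1 / m\<close> works.\<close>

lemma continuous_le_modulus_inj:
  fixes g h :: "'a::topological_space \<Rightarrow> real"
  assumes "compact S" "continuous_on S g" "continuous_on S h" "inj_on h S" "c \<in> S" "0 < e"
  obtains C where "0 \<le> C" "\<And>t. t \<in> S \<Longrightarrow> \<bar>g t - g c\<bar> \<le> e + C * \<bar>h t - h c\<bar>"
proof -
  let ?F = "S \<inter> (\<lambda>t. \<bar>g t - g c\<bar>) -` {e..}"
  have cg: "continuous_on S (\<lambda>t. \<bar>g t - g c\<bar>)" and ch: "continuous_on S (\<lambda>t. \<bar>h t - h c\<bar>)"
    using assms by (auto intro!: continuous_intros)
  obtain T where T: "closed T" "T \<inter> S = ?F"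
    using continuous_on_closed_invariant cg
    by (metis Int_commute closed_atLeast)
  then have F: "compact ?F" using assms(1) by (metis Int_commute compact_Int_closed)
  have Fh: "continuous_on ?F (\<lambda>t. \<bar>h t - h c\<bar> / \<bar>g t - g c\<bar>)"
    using continuous_on_subset[OF ch, of ?F] continuous_on_subset[OF cg, of ?F] assms(6)
    by (intro continuous_on_divide) auto
  have pos: "0 < \<bar>h t - h c\<bar> / \<bar>g t - g c\<bar>" if "t \<in> ?F" for t
  proof -
    have "t \<noteq> c" "t \<in> S" using that assms(6) by auto
    then have "h t \<noteq> h c" using assms(4,5) by (auto dest: inj_onD)
    then show ?thesis using that assms(6) by auto
  qed
  show thesis
  proof (cases "?F = {}")
    case True
    have "\<bar>g t - g c\<bar> \<le> e + 0 * \<bar>h t - h c\<bar>" if "t \<in> S" for t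
      using True that by force
    then show ?thesis using that[of 0] by blast
  next
    case False
    obtain p where p: "p \<in> ?F"
      "\<And>t. t \<in> ?F \<Longrightarrow> \<bar>h p - h c\<bar> / \<bar>g p - g c\<bar> \<le> \<bar>h t - h c\<bar> / \<bar>g t - g c\<bar>"
      using continuous_attains_inf[OF F False Fh] by blast
    define m where "m = \<bar>h p - h c\<bar> / \<bar>g p - g c\<bar>"
    have m: "0 < m" using pos[OF p(1)] by (simp add: m_def)
    show ?thesis
    proof (rule that[of "1 / m"])
      fix t assume t: "t \<in> S"
      show "\<bar>g t - g c\<bar> \<le> e + 1 / m * \<bar>h t - h c\<bar>"
      proof (cases "t \<in> ?F")
        case True
        then have "m \<le> \<bar>h t - h c\<bar> / \<bar>g t - g c\<bar>" "0 < \<bar>g t - g c\<bar>"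
          using p(2)[OF True] assms(6) by (auto simp: m_def)
        then show ?thesis using m assms(6) by (simp add: field_simps add_increasing)
      next
        case False
        then have "\<bar>g t - g c\<bar> \<le> e" using t by auto
        moreover have "0 \<le> 1 / m * \<bar>h t - h c\<bar>" using m by simp
        ultimately show ?thesis by linarith
      qed
    qed (use m in simp)
  qed
qed

text \<open>The constant \<open>C\<close> may depend on \<open>e\<close> but not on
  \<open>n\<close>: it is fixed for \<open>e / 2\<close> first, and then \<open>C * Y n\<close>
  drops below \<open>e / 2\<close>.\<close>

lemma tendsto_0_by_modulus:
  fixes X Y :: "nat \<Rightarrow> real"
  assumes "Y \<longlonglongrightarrow> 0" "\<And>e. 0 < e \<Longrightarrow> \<exists>C\<ge>0. \<forall>n. \<bar>X n\<bar> \<le> e + C * Y n"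
  shows "X \<longlonglongrightarrow> 0"
  unfolding tendsto_iff
proof safe
  fix e :: real assume e: "0 < e"
  then obtain C where C: "\<And>n. \<bar>X n\<bar> \<le> e / 2 + C * Y n" using assms(2)[of "e / 2"] by auto
  have "(\<lambda>n. C * Y n) \<longlonglongrightarrow> C * 0" by (intro tendsto_intros assms(1))
  then have "\<forall>\<^sub>F n in sequentially. C * Y n < e / 2"
    using e by (intro order_tendstoD(2)[of _ 0]) auto
  then show "\<forall>\<^sub>F n in sequentially. dist (X n) 0 < e"
  proof eventually_elim
    case (elim n)
    with C[of n] show ?case by (simp add: dist_real_def)
  qed
qed

section \<open>The Lyapunov function and convergence of the iterates\<close>

text \<open>Applying \<open>u\<close> to the bound turns \<open>u (qa_mean I u P)\<close> into an
  integral. Whether the inequality is preserved or reversed depends on the kind of bound and the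
  direction of \<open>u\<close>; in the unfavourable cases \<open>- u\<close> serves as
  \<open>w\<close>.\<close>

lemma bounded_family_Lyapunov:
  assumes I: "is_interval I" and adm: "admissible I f"
    and bdd: "upper_bounded I f \<or> lower_bounded I f"
  obtains w where "w \<in> CM I"
    "\<And>P x. P \<in> compact_probs I \<Longrightarrow> x \<in> {0..1} \<Longrightarrow> w (qa_mean I (f x) P) \<le> (LINT t|P. w t)"
proof -
  obtain u where u: "u \<in> CM I" and
    cmp: "(\<forall>x\<in>{0..1}. \<forall>P\<in>compact_probs I. qa_mean I (f x) P \<le> qa_mean I u P) \<or>
      (\<forall>x\<in>{0..1}. \<forall>P\<in>compact_probs I. qa_mean I u P \<le> qa_mean I (f x) P)"
    using bdd unfolding upper_bounded_def lower_bounded_def mean_le_def by blast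
  have "(\<forall>s\<in>I. \<forall>t\<in>I. s \<le> t \<longrightarrow> u s \<le> u t) \<or> (\<forall>s\<in>I. \<forall>t\<in>I. s \<le> t \<longrightarrow> u t \<le> u s)"
    using u unfolding CM_def monotone_on_def by (auto simp: order_le_less)
  with cmp have "(\<forall>x\<in>{0..1}. \<forall>P\<in>compact_probs I. u (qa_mean I (f x) P) \<le> u (qa_mean I u P)) \<or>
      (\<forall>x\<in>{0..1}. \<forall>P\<in>compact_probs I. u (qa_mean I u P) \<le> u (qa_mean I (f x) P))"
    using qa_mean_props(2)[OF I _ u] qa_mean_props(2)[OF I] adm
    unfolding admissible_def by meson
  then consider
      (le) "\<forall>x\<in>{0..1}. \<forall>P\<in>compact_probs I. u (qa_mean I (f x) P) \<le> (LINT t|P. u t)"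
    | (ge) "\<forall>x\<in>{0..1}. \<forall>P\<in>compact_probs I. (LINT t|P. u t) \<le> u (qa_mean I (f x) P)"
    using qa_mean_props(3)[OF I _ u] by auto
  then show thesis
  proof cases
    case le
    then show ?thesis using that[of u] u by blast
  next
    case ge
    have "(\<lambda>t. - u t) \<in> CM I"
      using u by (auto simp: CM_def monotone_on_def intro!: continuous_intros)
    then show ?thesis using that[of "\<lambda>t. - u t"] ge by auto
  qed
qed

text \<open>One point \<open>c\<close> must serve every \<open>k\<close>. It is therefore obtained
  from \<open>w\<close> alone, before any \<open>k\<close> is chosen.\<close>

lemma iterates_converge:
  assumes I: "is_interval I" and adm: "admissible I f"
    and bdd: "upper_bounded I f \<or> lower_bounded I f" and P: "P \<in> compact_probs I"
  shows "\<exists>c\<in>supp_hull P. c \<in> I \<and>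
    (\<forall>k\<in>CM I. (\<lambda>n. qa_mean I k ((mean_map I f ^^ n) P)) \<longlonglongrightarrow> c)"
proof -
  let ?L = "lebesgue_on {0..1::real}"
  interpret L: prob_space ?L by (rule prob_space_lebesgue_unit)
  obtain w where w: "w \<in> CM I" and
    Lyap: "\<And>P x. P \<in> compact_probs I \<Longrightarrow> x \<in> {0..1} \<Longrightarrow> w (qa_mean I (f x) P) \<le> (LINT t|P. w t)"
    using bounded_family_Lyapunov[OF I adm bdd] by metis
  note wc = CM_continuous[OF w]
  obtain a b where ab: "supp_hull P = {a..b}" "a \<le> b" "{a..b} \<subseteq> I" "AE t in P. t \<in> {a..b}"
    by (rule compact_probs_hull[OF I P])
  define Q where "Q n = (mean_map I f ^^ n) P" for n
  have Q_Suc: "Q (Suc n) = mean_map I f (Q n)" for n by (simp add: Q_def)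
  \<comment> \<open>All iterates share the compact interval \<open>{a..b}\<close>, so constants
    found by compactness on it are independent of \<open>n\<close>.\<close>
  have Q_hull: "Q n \<in> compact_probs I \<and> supp_hull (Q n) \<subseteq> {a..b}" for n
  proof (induction n)
    case 0
    then show ?case using P ab by (simp add: Q_def)
  next
    case (Suc n)
    then show ?case using mean_map_props(1,2)[OF I adm, of "Q n"] by (auto simp: Q_Suc)
  qed
  then have Q: "Q n \<in> compact_probs I" and prob: "prob_space (Q n)" for n
    by (auto simp: compact_probs_def)
  have AE: "AE t in Q n. t \<in> {a..b}" for n
    by (rule compact_probs_hull[OF I Q[of n]]) 
      (rule eventually_mono, use Q_hull[of n] in auto)
  define V where "V n = (LINT t|Q n. w t)" for n
  \<comment> \<open>Staying in a compact set of values of \<open>w\<close> bounds \<open>V\<close>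
    below and makes its limit a value \<open>w c\<close>.\<close>
  have V_mem: "V n \<in> w ` {a..b}" for n
    unfolding V_def by (rule integral_mem_image[OF I Q wc ab(2,3) AE])
  have cmpw: "compact (w ` {a..b})"
    by (intro compact_continuous_image continuous_on_subset[OF wc] ab) auto
  have int: "integrable ?L (\<lambda>x. w (qa_mean I (f x) (Q n)))"
    and V_Suc: "V (Suc n) = (LINT x|?L. w (qa_mean I (f x) (Q n)))" for n
    using mean_map_props(3)[OF I adm Q wc, of n] by (auto simp: V_def Q_Suc)
  have "V (Suc n) \<le> V n" for n
  proof -
    have "AE x in ?L. w (qa_mean I (f x) (Q n)) \<le> V n"
      unfolding V_def by (intro AE_I2 Lyap Q) simp
    then show ?thesis unfolding V_Suc using int by (rule L.integral_le_const[rotated])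
  qed
  then have "decseq V" by (rule decseq_SucI)
  moreover obtain B where "\<forall>n. B \<le> V n"
    using bounded_imp_bdd_below[OF compact_imp_bounded[OF cmpw]] V_mem
    by (meson bdd_below.E)
  ultimately obtain l where l: "V \<longlonglongrightarrow> l" by (rule decseq_convergent)
  then have "l \<in> w ` {a..b}"
    by (rule closed_sequentially[OF compact_imp_closed[OF cmpw] V_mem])
  then obtain c where c: "c \<in> {a..b}" "l = w c" by blast
  \<comment> \<open>The triangle inequality through \<open>V n\<close> is used pointwise in
    \<open>x\<close>. The part \<open>V n - w (qa_mean I (f x) (Q n))\<close> needs no absolute
    value by \<open>Lyap\<close>, so it integrates to the telescoping difference.\<close>
  have dist_le: "(LINT t|Q (Suc n). \<bar>w t - w c\<bar>) \<le> V n - V (Suc n) + \<bar>V n - w c\<bar>" for n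
  proof -
    have cont: "continuous_on I (\<lambda>t. \<bar>w t - w c\<bar>)" by (intro continuous_intros wc)
    note M = mean_map_props(3)[OF I adm Q cont, of n]
    have "(LINT t|Q (Suc n). \<bar>w t - w c\<bar>) = (LINT x|?L. \<bar>w (qa_mean I (f x) (Q n)) - w c\<bar>)"
      using M by (simp add: Q_Suc)
    also have "\<dots> \<le> (LINT x|?L. (V n - w (qa_mean I (f x) (Q n))) + \<bar>V n - w c\<bar>)"
    proof (rule integral_mono)
      fix x assume "x \<in> space ?L"
      then have "w (qa_mean I (f x) (Q n)) \<le> V n"
        unfolding V_def by (intro Lyap Q) simp
      then show "\<bar>w (qa_mean I (f x) (Q n)) - w c\<bar>
          \<le> (V n - w (qa_mean I (f x) (Q n))) + \<bar>V n - w c\<bar>" by linarith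
    qed (use M int in auto)
    also have "\<dots> = V n - V (Suc n) + \<bar>V n - w c\<bar>"
      using int L.prob_space by (simp add: V_Suc)
    finally show ?thesis .
  qed
  have D: "(\<lambda>n. LINT t|Q n. \<bar>w t - w c\<bar>) \<longlonglongrightarrow> 0"
  \<comment> \<open>The bound \<open>dist_le\<close> concerns the index \<open>Suc n\<close>, so
    convergence is shown for the shifted sequence.\<close>
  proof (rule LIMSEQ_imp_Suc, rule tendsto_sandwich)
    show "\<forall>\<^sub>F n in sequentially. 0 \<le> (LINT t|Q (Suc n). \<bar>w t - w c\<bar>)" by simp
    show "\<forall>\<^sub>F n in sequentially. (LINT t|Q (Suc n). \<bar>w t - w c\<bar>)
        \<le> V n - V (Suc n) + \<bar>V n - w c\<bar>" using dist_le by simp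
    have "(\<lambda>n. V n - V (Suc n) + \<bar>V n - w c\<bar>) \<longlonglongrightarrow> l - l + \<bar>l - w c\<bar>"
      by (intro tendsto_intros l LIMSEQ_Suc)
    then show "(\<lambda>n. V n - V (Suc n) + \<bar>V n - w c\<bar>) \<longlonglongrightarrow> 0" by (simp add: c)
  qed simp
  have "(\<lambda>n. qa_mean I k (Q n)) \<longlonglongrightarrow> c" if k: "k \<in> CM I" for k
  proof -
    note kc = CM_continuous[OF k]
    have qa: "qa_mean I k (Q n) \<in> {a..b}" "k (qa_mean I k (Q n)) = (LINT t|Q n. k t)" for n
      using qa_mean_props(1,3)[OF I Q k, of n] Q_hull[of n] by (blast, simp)
    \<comment> \<open>The comparison of \<open>k\<close> with the injective \<open>w\<close> holds
      pointwise on \<open>{a..b}\<close>; integrating it over \<open>Q n\<close> bounds the left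
      side by \<open>e\<close> plus a multiple of the quantity in \<open>D\<close>.\<close>
    have "(\<lambda>n. k (qa_mean I k (Q n)) - k c) \<longlonglongrightarrow> 0"
    proof (rule tendsto_0_by_modulus[OF D])
      fix e :: real assume e: "0 < e"
      obtain C where C: "0 \<le> C" "\<And>t. t \<in> {a..b} \<Longrightarrow> \<bar>k t - k c\<bar> \<le> e + C * \<bar>w t - w c\<bar>"
        using continuous_le_modulus_inj[OF compact_Icc continuous_on_subset[OF kc ab(3)]
            continuous_on_subset[OF wc ab(3)] inj_on_subset[OF CM_inj[OF w] ab(3)] c(1) e] by blast
      have "\<bar>k (qa_mean I k (Q n)) - k c\<bar> \<le> e + C * (LINT t|Q n. \<bar>w t - w c\<bar>)" for n
      proof -
        interpret prob_space "Q n" by (rule prob)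
        have ik: "integrable (Q n) k" and iw: "integrable (Q n) (\<lambda>t. \<bar>w t - w c\<bar>)"
          by (intro compact_probs_integrable[OF I Q] continuous_intros kc wc)+
        have "k (qa_mean I k (Q n)) - k c = (LINT t|Q n. k t - k c)"
          using ik by (simp add: qa prob_space)
        also have "\<bar>\<dots>\<bar> \<le> (LINT t|Q n. \<bar>k t - k c\<bar>)"
          by (rule integral_abs_bound)
        also have "\<dots> \<le> (LINT t|Q n. e + C * \<bar>w t - w c\<bar>)"
          using ik iw by (intro integral_mono_AE eventually_mono[OF AE[of n] C(2)]) auto
        also have "\<dots> = e + C * (LINT t|Q n. \<bar>w t - w c\<bar>)"
          using iw by (simp add: prob_space)
        finally show ?thesis .
      qed
      then show "\<exists>C\<ge>0. \<forall>n. \<bar>k (qa_mean I k (Q n)) - k c\<bar> \<le> e + C * (LINT t|Q n. \<bar>w t - w c\<bar>)"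
        using C(1) by blast
    qed
    then have E: "(\<lambda>n. \<bar>k (qa_mean I k (Q n)) - k c\<bar>) \<longlonglongrightarrow> 0" by (rule tendsto_rabs_zero)
    \<comment> \<open>The same comparison, now of the identity with the injective \<open>k\<close>,
      replaces continuity of the inverse of \<open>k\<close>.\<close>
    have "(\<lambda>n. qa_mean I k (Q n) - c) \<longlonglongrightarrow> 0"
    proof (rule tendsto_0_by_modulus[OF E])
      fix e :: real assume e: "0 < e"
      show "\<exists>C\<ge>0. \<forall>n. \<bar>qa_mean I k (Q n) - c\<bar> \<le> e + C * \<bar>k (qa_mean I k (Q n)) - k c\<bar>"
        using continuous_le_modulus_inj[OF compact_Icc continuous_on_id
            continuous_on_subset[OF kc ab(3)] inj_on_subset[OF CM_inj[OF k] ab(3)] c(1) e] qa(1)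
        by metis
    qed
    then show ?thesis by (simp add: LIM_zero_iff)
  qed
  then show ?thesis using c(1) ab unfolding Q_def by (intro bexI[of _ c]) auto
qed

theorem theorem2:
  fixes I :: "real set" and f :: "real \<Rightarrow> real \<Rightarrow> real"
  assumes "is_interval I"
    and "admissible I f"
    and "upper_bounded I f \<or> lower_bounded I f"
  shows "\<exists>!K. invariant_mean I f K \<and>
           (\<forall>k\<in>CM I. \<forall>P\<in>compact_probs I.
              (\<lambda>n. qa_mean I k ((mean_map I f ^^ n) P)) \<longlonglongrightarrow> K P)"
proof -
  obtain K0 where K0: "\<And>P. P \<in> compact_probs I \<Longrightarrow> K0 P \<in> supp_hull P \<and> K0 P \<in> I \<and>
      (\<forall>k\<in>CM I. (\<lambda>n. qa_mean I k ((mean_map I f ^^ n) P)) \<longlonglongrightarrow> K0 P)"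
    using iterates_converge[OF assms] by metis
  \<comment> \<open>The restriction supplies the extensionality built into \<open>is_mean\<close>,
    on which uniqueness as a HOL function rests.\<close>
  define K where "K = restrict K0 (compact_probs I)"
  have id: "(\<lambda>t. t) \<in> CM I" by (auto simp: CM_def monotone_on_def)
  have lim: "(\<lambda>n. qa_mean I k ((mean_map I f ^^ n) P)) \<longlonglongrightarrow> K P"
    if "k \<in> CM I" "P \<in> compact_probs I" for k P
    using that K0 by (simp add: K_def)
  have mean: "is_mean I K"
    using K0 by (auto simp: is_mean_def K_def)
  \<comment> \<open>The iterates of \<open>mean_map I f P\<close> are those of \<open>P\<close>
    shifted by one, so both values are limits of the same sequence. The identity is a convenient
    choice of \<open>k\<close>.\<close>
  have "K (mean_map I f P) = K P" if P: "P \<in> compact_probs I" for P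
  proof (rule LIMSEQ_unique)
    show "(\<lambda>n. qa_mean I (\<lambda>t. t) ((mean_map I f ^^ n) (mean_map I f P)))
        \<longlonglongrightarrow> K (mean_map I f P)"
      by (rule lim[OF id mean_map_props(1)[OF assms(1,2) P]])
    show "(\<lambda>n. qa_mean I (\<lambda>t. t) ((mean_map I f ^^ n) (mean_map I f P))) \<longlonglongrightarrow> K P"
      using LIMSEQ_Suc[OF lim[OF id P]] by (simp add: funpow_swap1)
  qed
  with mean lim have ex: "invariant_mean I f K \<and> (\<forall>k\<in>CM I. \<forall>P\<in>compact_probs I.
      (\<lambda>n. qa_mean I k ((mean_map I f ^^ n) P)) \<longlonglongrightarrow> K P)"
    by (auto simp: invariant_mean_def)
  show ?thesis
  proof (rule ex1I, rule ex)
    fix K' assume K': "invariant_mean I f K' \<and> (\<forall>k\<in>CM I. \<forall>P\<in>compact_probs I.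
      (\<lambda>n. qa_mean I k ((mean_map I f ^^ n) P)) \<longlonglongrightarrow> K' P)"
    \<comment> \<open>Limits along the identity determine the value at each measure in
      \<open>compact_probs I\<close>; elsewhere both functions are undefined by
      extensionality.\<close>
    show "K' = K"
    proof (rule PiE_ext)
      show "K' \<in> compact_probs I \<rightarrow>\<^sub>E I" "K \<in> compact_probs I \<rightarrow>\<^sub>E I"
        using K' mean by (auto simp: invariant_mean_def is_mean_def)
      show "K' P = K P" if "P \<in> compact_probs I" for P
        using K' lim[OF id that] id that LIMSEQ_unique by blast
    qed
  qed
qed

end
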